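(* For $\lambda>0$, consider the $2$-jump normal game and the $2$-jump misère game, each started at the root of the Galton-Watson tree with Poisson$(\lambda)$ offspring distribution. Let $n\ell_{2,\lambda}$, $nw_{2,\lambda}$, $nd_{2,\lambda}$ be the probabilities that, in the normal game, the first player loses, the first player wins, and the game is a draw, respectively; let $m\ell_{2,\lambda}$, $md_{2,\lambda}$ be the probabilities that, in the misère game, the first player loses and the game is a draw, respectively. Then for all $\lambda$ sufficiently large, $$m\ell_{2,\lambda}\le n\ell_{2,\lambda},\qquad nd_{2,\lambda}<md_{2,\lambda},\qquad m\ell_{2,\lambda}\le n\ell_{2,\lambda}<nw_{2,\lambda}.$$
   Context: In the Galton-Watson tree every vertex independently has a Poisson$(\lambda)$ number of children. In the $2$-jump games a token starts at a vertex; two players alternate, a move relocating the token from its current vertex to any child or grandchild of it. In the normal game a player unable to move loses; in the misère game a player unable to move wins. The whole tree is known to both players and both play optimally; a game that goes on forever is a draw. *)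

theory Defs
  imports "HOL-Probability.Probability"
begin

text \<open>A game is given by the set of legal moves at each position. The first player moves at
  even times, the second player at odd times.\<close>

datatype convention = Normal | Misere

datatype player = First | Second

definition to_move :: "nat \<Rightarrow> player" where
  "to_move n = (if even n then First else Second)"

definition opponent :: "player \<Rightarrow> player" where
  "opponent p = (case p of First \<Rightarrow> Second | Second \<Rightarrow> First)"

text \<open>A strategy maps the history of the play (the nonempty list of positions visited so far,
  current position last) to the next position.\<close>

type_synonym 'v strategy = "'v list \<Rightarrow> 'v"

definition legal_strategy :: "('v \<Rightarrow> 'v set) \<Rightarrow> 'v strategy \<Rightarrow> bool" where
  "legal_strategy moves \<sigma> \<longleftrightarrow>
     (\<forall>h. h \<noteq> [] \<longrightarrow> moves (last h) \<noteq> {} \<longrightarrow> \<sigma> h \<in> moves (last h))"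

text \<open>The history after \<open>n\<close> moves when the first player uses \<open>\<sigma>\<close> and the second \<open>\<tau>\<close>. Beyond the
  first terminal position it carries no meaning and is ignored below.\<close>

primrec history :: "'v strategy \<Rightarrow> 'v strategy \<Rightarrow> 'v \<Rightarrow> nat \<Rightarrow> 'v list" where
  "history \<sigma> \<tau> x 0 = [x]"
| "history \<sigma> \<tau> x (Suc n) =
     (let h = history \<sigma> \<tau> x n in h @ [case to_move n of First \<Rightarrow> \<sigma> h | Second \<Rightarrow> \<tau> h])"

definition play :: "'v strategy \<Rightarrow> 'v strategy \<Rightarrow> 'v \<Rightarrow> nat \<Rightarrow> 'v" where
  "play \<sigma> \<tau> x n = last (history \<sigma> \<tau> x n)"

definition ends_at :: "('v \<Rightarrow> 'v set) \<Rightarrow> (nat \<Rightarrow> 'v) \<Rightarrow> nat \<Rightarrow> bool" where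
  "ends_at moves q n \<longleftrightarrow> moves (q n) = {} \<and> (\<forall>k<n. moves (q k) \<noteq> {})"

text \<open>An infinite play is won by nobody.\<close>

definition play_won_by ::
  "convention \<Rightarrow> ('v \<Rightarrow> 'v set) \<Rightarrow> player \<Rightarrow> (nat \<Rightarrow> 'v) \<Rightarrow> bool" where
  "play_won_by conv moves p q \<longleftrightarrow>
     (\<exists>n. ends_at moves q n \<and>
        p = (case conv of Normal \<Rightarrow> opponent (to_move n) | Misere \<Rightarrow> to_move n))"

definition first_wins :: "convention \<Rightarrow> ('v \<Rightarrow> 'v set) \<Rightarrow> 'v \<Rightarrow> bool" where
  "first_wins conv moves x \<longleftrightarrow>
     (\<exists>\<sigma>. legal_strategy moves \<sigma> \<and>
        (\<forall>\<tau>. legal_strategy moves \<tau> \<longrightarrow> play_won_by conv moves First (play \<sigma> \<tau> x)))"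

definition first_loses :: "convention \<Rightarrow> ('v \<Rightarrow> 'v set) \<Rightarrow> 'v \<Rightarrow> bool" where
  "first_loses conv moves x \<longleftrightarrow>
     (\<exists>\<tau>. legal_strategy moves \<tau> \<and>
        (\<forall>\<sigma>. legal_strategy moves \<sigma> \<longrightarrow> play_won_by conv moves Second (play \<sigma> \<tau> x)))"

text \<open>Under optimal play the game is drawn when neither player can force a win.\<close>

definition drawn :: "convention \<Rightarrow> ('v \<Rightarrow> 'v set) \<Rightarrow> 'v \<Rightarrow> bool" where
  "drawn conv moves x \<longleftrightarrow> \<not> first_wins conv moves x \<and> \<not> first_loses conv moves x"

text \<open>Ulam-Harris encoding: the root is \<open>[]\<close> and the children of \<open>v\<close> are \<open>v @ [i]\<close> for \<open>i < c v\<close>,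
  where \<open>c v\<close> is the offspring number of \<open>v\<close>. Offspring numbers are also attached to labels that
  do not occur in the tree; no play from the root ever reaches those.\<close>

type_synonym vertex = "nat list"

definition children :: "(vertex \<Rightarrow> nat) \<Rightarrow> vertex \<Rightarrow> vertex set" where
  "children c v = {v @ [i] | i. i < c v}"

definition moves2 :: "(vertex \<Rightarrow> nat) \<Rightarrow> vertex \<Rightarrow> vertex set" where
  "moves2 c v = children c v \<union> (\<Union>u\<in>children c v. children c u)"

definition GW :: "real \<Rightarrow> (vertex \<Rightarrow> nat) measure" where
  "GW r = PiM UNIV (\<lambda>_. measure_pmf (poisson_pmf r))"

text \<open>The games start at the root \<open>[]\<close>. The prefixes \<open>n\<close> and \<open>m\<close> stand for normal and misere;
  \<open>l\<close>, \<open>w\<close>, \<open>d\<close> for the first player losing, winning, and a draw.\<close>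

definition nl2 :: "real \<Rightarrow> real" where
  "nl2 r = measure (GW r) {c \<in> space (GW r). first_loses Normal (moves2 c) []}"

definition nw2 :: "real \<Rightarrow> real" where
  "nw2 r = measure (GW r) {c \<in> space (GW r). first_wins Normal (moves2 c) []}"

definition nd2 :: "real \<Rightarrow> real" where
  "nd2 r = measure (GW r) {c \<in> space (GW r). drawn Normal (moves2 c) []}"

definition ml2 :: "real \<Rightarrow> real" where
  "ml2 r = measure (GW r) {c \<in> space (GW r). first_loses Misere (moves2 c) []}"

definition md2 :: "real \<Rightarrow> real" where
  "md2 r = measure (GW r) {c \<in> space (GW r). drawn Misere (moves2 c) []}"

end

theory Submission
  imports Defs "HOL-Real_Asymp.Real_Asymp"
begin

text \<open>For large \<open>r\<close> almost every tree is a draw in both games, and everything is decided by the rare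
  vertices without children, which occur with probability \<open>exp (- r)\<close>.

  In the normal game such a vertex is lost. This is the dominant way to lose, so the loss
  probability lies between \<open>exp (- r)\<close> and \<open>2 * exp (- r)\<close>. A vertex that has a leaf as a child wins,
  which happens with probability \<open>1 - exp (- r * exp (- r))\<close>, about \<open>r * exp (- r)\<close>; hence wins are
  more likely than losses.

  In the misere game a leaf is won. To be lost, a vertex must have children, and all of them must
  be won and have only won children, which is unlikely even for a single child; the loss
  probability is at most \<open>2 * r * exp (- 3 / 2 * r)\<close>, of smaller order than \<open>exp (- r)\<close>. The wins created by the lost
  vertices are therefore negligible too, and the win probability is about \<open>exp (- r)\<close>. So the misere
  game is decided with probability about \<open>exp (- r)\<close>, the normal game with probability at least
  of the order \<open>r * exp (- r)\<close>, and the misere game is the one with more draws.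

  The upper bounds are proved by induction over the stages of backward induction
  (\<open>measure_loss_trees_le\<close>, \<open>win_prob_le\<close>). Because each position has finitely many moves, these
  stages exhaust the outcome classes defined by strategies (\<open>first_wins_iff\<close>, \<open>first_loses_iff\<close>),
  which also makes these classes measurable. The probabilities are computed from
  the branching property (\<open>measure_all_children\<close>): all children of the root have a
  property of probability \<open>a\<close> with probability \<open>exp (- r * (1 - a))\<close>.\<close>

section \<open>Backward induction in finitely branching games\<close>

text \<open>The outcome classes grow in stages, stage \<open>n\<close> consisting of the positions decided within \<open>n\<close>
  rounds. A terminal position counts as an immediate win for the player to move in the
  misere game and as an immediate loss in the normal game, where the universal quantifier over moves
  is vacuous. Nothing is decided within \<open>0\<close> rounds, so terminal positions are decided at stage \<open>1\<close>.\<close>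

fun wins_within loses_within :: "convention \<Rightarrow> ('v \<Rightarrow> 'v set) \<Rightarrow> nat \<Rightarrow> 'v \<Rightarrow> bool" where
  "wins_within conv moves 0 x \<longleftrightarrow> False"
| "loses_within conv moves 0 x \<longleftrightarrow> False"
| "wins_within conv moves (Suc n) x \<longleftrightarrow>
     (conv = Misere \<and> moves x = {}) \<or> (\<exists>y\<in>moves x. loses_within conv moves n y)"
| "loses_within conv moves (Suc n) x \<longleftrightarrow>
     \<not> (conv = Misere \<and> moves x = {}) \<and> (\<forall>y\<in>moves x. wins_within conv moves n y)"

lemma within_Suc:
  "(wins_within conv moves n x \<longrightarrow> wins_within conv moves (Suc n) x) \<and>
   (loses_within conv moves n x \<longrightarrow> loses_within conv moves (Suc n) x)"
proof (induction n arbitrary: x)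
  case 0
  then show ?case by simp
next
  case (Suc n)
  then have "wins_within conv moves n y \<Longrightarrow> wins_within conv moves (Suc n) y"
    and "loses_within conv moves n y \<Longrightarrow> loses_within conv moves (Suc n) y" for y by blast+
  note IH = this
  show ?case
  proof (intro conjI impI)
    assume "wins_within conv moves (Suc n) x"
    then have "(conv = Misere \<and> moves x = {}) \<or> (\<exists>y\<in>moves x. loses_within conv moves n y)"
      by simp
    then have "(conv = Misere \<and> moves x = {}) \<or> (\<exists>y\<in>moves x. loses_within conv moves (Suc n) y)"
      using IH(2) by (elim disj_forward bexE) (assumption, rule bexI)
    then show "wins_within conv moves (Suc (Suc n)) x"
      by (rule wins_within.simps(2)[THEN iffD2])
  next
    assume "loses_within conv moves (Suc n) x"
    then have "\<not> (conv = Misere \<and> moves x = {}) \<and> (\<forall>y\<in>moves x. wins_within conv moves n y)"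
      by simp
    then have "\<not> (conv = Misere \<and> moves x = {}) \<and> (\<forall>y\<in>moves x. wins_within conv moves (Suc n) y)"
      using IH(1) by (elim conj_forward) (assumption, rule ballI, drule bspec)
    then show "loses_within conv moves (Suc (Suc n)) x"
      by (rule loses_within.simps(2)[THEN iffD2])
  qed
qed

lemma wins_within_mono:
  assumes "wins_within conv moves m x" "m \<le> n"
  shows "wins_within conv moves n x"
  using assms(2)
proof (induction rule: dec_induct)
  case base
  show ?case by (fact assms(1))
next
  case (step k)
  show ?case by (rule within_Suc[THEN conjunct1, THEN mp, OF step.IH])
qed

lemma loses_within_mono:
  assumes "loses_within conv moves m x" "m \<le> n"
  shows "loses_within conv moves n x"
  using assms(2)
proof (induction rule: dec_induct)
  case base
  show ?case by (fact assms(1))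
next
  case (step k)
  show ?case by (rule within_Suc[THEN conjunct2, THEN mp, OF step.IH])
qed

text \<open>One positional rule serves both purposes of a player: from a winning position it moves so that
  the number of remaining rounds decreases, from a position that is not lost it avoids handing the
  opponent a winning one.\<close>

definition best_move :: "convention \<Rightarrow> ('v \<Rightarrow> 'v set) \<Rightarrow> 'v \<Rightarrow> 'v" where
  "best_move conv moves x = (SOME y. y \<in> moves x \<and>
     (\<forall>n. wins_within conv moves (Suc n) x \<longrightarrow> loses_within conv moves n y) \<and>
     ((\<forall>n. \<not> loses_within conv moves n x) \<longrightarrow> (\<forall>n. \<not> wins_within conv moves n y)))"

lemma not_both_within: "\<not> (wins_within conv moves n x \<and> loses_within conv moves n x)"
  by (induction n arbitrary: x) auto

text \<open>Finiteness of the set of moves is what makes the avoiding move exist: if all moves led to positions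
  won by the opponent, then the stages of these finitely many wins would have a maximum \<open>N\<close>, and
  \<open>x\<close> itself would be lost within \<open>N + 1\<close> rounds.\<close>

lemma best_move:
  assumes fin: "\<forall>x. finite (moves x)" and ne: "moves x \<noteq> {}"
  shows "best_move conv moves x \<in> moves x"
    and "wins_within conv moves (Suc n) x \<Longrightarrow> loses_within conv moves n (best_move conv moves x)"
    and "(\<And>n. \<not> loses_within conv moves n x) \<Longrightarrow>
           \<not> wins_within conv moves n (best_move conv moves x)"
proof -
  let ?P = "\<lambda>y. y \<in> moves x \<and>
     (\<forall>n. wins_within conv moves (Suc n) x \<longrightarrow> loses_within conv moves n y) \<and>
     ((\<forall>n. \<not> loses_within conv moves n x) \<longrightarrow> (\<forall>n. \<not> wins_within conv moves n y))"
  have "\<exists>y. ?P y"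
  proof (cases "\<exists>n. wins_within conv moves (Suc n) x")
    case True
    define m where "m = (LEAST n. wins_within conv moves (Suc n) x)"
    from True have "wins_within conv moves (Suc m) x"
      unfolding m_def by (rule LeastI_ex)
    \<comment> \<open>The minimal stage \<open>m\<close> gives one move that is good for every stage at which \<open>x\<close> is a win.\<close>
    with ne obtain y where y: "y \<in> moves x" "loses_within conv moves m y"
      by auto
    have "loses_within conv moves n y" if "wins_within conv moves (Suc n) x" for n
      using y(2) Least_le[of "\<lambda>n. wins_within conv moves (Suc n) x", OF that]
      unfolding m_def by (rule loses_within_mono)
    moreover have "\<not> wins_within conv moves n y" for n
      using not_both_within[of conv moves "max m n" y] y(2)
        loses_within_mono[of conv moves m y "max m n"] wins_within_mono[of conv moves n y "max m n"]
      by auto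
    ultimately show ?thesis using y(1) by blast
  next
    case False
    show ?thesis
    proof (cases "\<exists>y\<in>moves x. \<forall>n. \<not> wins_within conv moves n y")
      case True
      with False show ?thesis by blast
    next
      case all: False
      then obtain N where N: "\<And>y. y \<in> moves x \<Longrightarrow> wins_within conv moves (N y) y"
        by metis
      have "wins_within conv moves (Max (N ` moves x)) y" if "y \<in> moves x" for y
        using N[OF that] by (rule wins_within_mono) (use fin that in simp)
      with ne have "loses_within conv moves (Suc (Max (N ` moves x))) x" by auto
      with False ne show ?thesis by blast
    qed
  qed
  then have "?P (best_move conv moves x)"
    unfolding best_move_def by (rule someI_ex)
  then show "best_move conv moves x \<in> moves x"
    and "wins_within conv moves (Suc n) x \<Longrightarrow> loses_within conv moves n (best_move conv moves x)"
    and "(\<And>n. \<not> loses_within conv moves n x) \<Longrightarrow>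
           \<not> wins_within conv moves n (best_move conv moves x)"
    by auto
qed

definition winner :: "convention \<Rightarrow> nat \<Rightarrow> player" where
  "winner conv n = (case conv of Normal \<Rightarrow> opponent (to_move n) | Misere \<Rightarrow> to_move n)"

definition plays_best ::
  "convention \<Rightarrow> ('v \<Rightarrow> 'v set) \<Rightarrow> player \<Rightarrow> (nat \<Rightarrow> 'v) \<Rightarrow> bool" where
  "plays_best conv moves p q \<longleftrightarrow>
     (\<forall>k. moves (q k) \<noteq> {} \<longrightarrow> q (Suc k) \<in> moves (q k) \<and>
        (to_move k = p \<longrightarrow> q (Suc k) = best_move conv moves (q k)))"

lemma to_move_Suc: "to_move (Suc k) = p \<longleftrightarrow> to_move k \<noteq> p"
  by (cases p) (auto simp: to_move_def)

lemma winner_eq: "winner conv k = p \<longleftrightarrow> (if conv = Misere then to_move k = p else to_move k \<noteq> p)"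
  by (cases p; cases conv; cases "to_move k") (auto simp: winner_def opponent_def)

text \<open>Each move decreases the stage by one, and stage \<open>0\<close> decides nothing, so the play must reach
  a terminal position, and there stage \<open>1\<close> agrees with the convention of the game.\<close>

lemma plays_best_wins:
  assumes fin: "\<forall>x. finite (moves x)" and q: "plays_best conv moves p q"
    and adv: "if to_move k = p then wins_within conv moves n (q k)
              else loses_within conv moves n (q k)"
  shows "\<exists>j\<ge>k. moves (q j) = {} \<and> (\<forall>i. k \<le> i \<and> i < j \<longrightarrow> moves (q i) \<noteq> {}) \<and> winner conv j = p"
  using adv
proof (induction n arbitrary: k)
  case 0
  then show ?case by (simp split: if_splits)
next
  case (Suc n)
  show ?case
  proof (cases "moves (q k) = {}")
    case True
    with Suc.prems have "winner conv k = p"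
      unfolding winner_eq by (auto split: if_splits)
    with True show ?thesis by (intro exI[of _ k]) auto
  next
    case False
    have "if to_move (Suc k) = p then wins_within conv moves n (q (Suc k))
          else loses_within conv moves n (q (Suc k))"
      using q False Suc.prems best_move(2)[OF fin False, of conv n]
      unfolding plays_best_def to_move_Suc by (auto split: if_splits)
    from Suc.IH[OF this] obtain j where j: "j \<ge> Suc k" "moves (q j) = {}"
      "\<forall>i. Suc k \<le> i \<and> i < j \<longrightarrow> moves (q i) \<noteq> {}" "winner conv j = p" by blast
    with False show ?thesis
      by (intro exI[of _ j]) (metis Suc_leD le_antisym not_less_eq_eq)
  qed
qed

text \<open>The invariant "not lost for \<open>p\<close>" survives all moves up to a terminal position; since every
  terminal position is decided at stage \<open>1\<close>, it is then won by \<open>p\<close>.\<close>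

lemma plays_best_never_loses:
  assumes fin: "\<forall>x. finite (moves x)" and q: "plays_best conv moves p q"
    and start: "\<And>n. \<not> (if to_move 0 = p then loses_within conv moves n (q 0)
                  else wins_within conv moves n (q 0))"
    and ends: "ends_at moves q j"
  shows "winner conv j = p"
proof -
  have "\<not> (if to_move k = p then loses_within conv moves n (q k)
            else wins_within conv moves n (q k))" if "k \<le> j" for k n
    using that
  proof (induction k arbitrary: n)
    case 0
    then show ?case using start by simp
  next
    case (Suc k)
    then have ne: "moves (q k) \<noteq> {}" using ends unfolding ends_at_def by simp
    note IH = Suc.IH[OF Suc_leD[OF Suc.prems]]
    show ?case
    proof (cases "to_move k = p")
      case True
      then show ?thesis
        using q ne IH best_move(3)[OF fin ne, of conv n] unfolding plays_best_def to_move_Suc by auto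
    next
      case False
      then have "\<not> loses_within conv moves n y" if "y \<in> moves (q k)" for y
        using IH[of "Suc n"] that unfolding wins_within.simps by auto
      with False show ?thesis
        using q ne unfolding plays_best_def to_move_Suc by auto
    qed
  qed
  from this[of j "Suc 0"] show ?thesis
    using ends unfolding winner_eq ends_at_def by (auto split: if_splits)
qed

lemma history_nonempty: "history \<sigma> \<tau> x n \<noteq> []"
  by (cases n) (auto simp: Let_def)

lemma play_Suc:
  "play \<sigma> \<tau> x (Suc n) =
     (if to_move n = First then \<sigma> (history \<sigma> \<tau> x n) else \<tau> (history \<sigma> \<tau> x n))"
  by (auto simp: play_def Let_def split: player.splits)

lemma play_0: "play \<sigma> \<tau> x 0 = x"
  by (simp add: play_def)

abbreviation best_strategy :: "convention \<Rightarrow> ('v \<Rightarrow> 'v set) \<Rightarrow> 'v strategy" where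
  "best_strategy conv moves \<equiv> (\<lambda>h. best_move conv moves (last h))"

lemma legal_best_strategy:
  assumes "\<forall>x. finite (moves x)"
  shows "legal_strategy moves (best_strategy conv moves)"
  using best_move(1)[OF assms] by (auto simp: legal_strategy_def)

lemma plays_best_play:
  assumes "legal_strategy moves \<sigma>" "legal_strategy moves \<tau>"
    and "(if p = First then \<sigma> else \<tau>) = best_strategy conv moves"
  shows "plays_best conv moves p (play \<sigma> \<tau> x)"
  using assms history_nonempty[of \<sigma> \<tau> x]
  unfolding plays_best_def play_Suc legal_strategy_def
  by (cases p) (auto simp: play_def to_move_def)

lemma play_won_by_iff: "play_won_by conv moves p q \<longleftrightarrow> (\<exists>n. ends_at moves q n \<and> winner conv n = p)"
  by (auto simp: play_won_by_def winner_def)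

text \<open>Strategies may depend on the whole history, but a positional reply is enough to beat or to hold
  any of them. This turns the outcome classes into countable unions of stages.\<close>

lemma first_wins_iff:
  assumes fin: "\<forall>x. finite (moves x)"
  shows "first_wins conv moves x \<longleftrightarrow> (\<exists>n. wins_within conv moves n x)"
proof
  assume "first_wins conv moves x"
  then obtain \<sigma> where \<sigma>: "legal_strategy moves \<sigma>"
    "\<And>\<tau>. legal_strategy moves \<tau> \<Longrightarrow> play_won_by conv moves First (play \<sigma> \<tau> x)"
    unfolding first_wins_def by blast
  let ?q = "play \<sigma> (best_strategy conv moves) x"
  have q: "plays_best conv moves Second ?q"
    using \<sigma>(1) legal_best_strategy[OF fin] by (rule plays_best_play) simp
  obtain j where j: "ends_at moves ?q j" "winner conv j = First"
    using \<sigma>(2)[OF legal_best_strategy[OF fin]] unfolding play_won_by_iff by blast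
  show "\<exists>n. wins_within conv moves n x"
  proof (rule ccontr)
    assume "\<nexists>n. wins_within conv moves n x"
    then have "winner conv j = Second"
      by (intro plays_best_never_loses[OF fin q _ j(1)]) (auto simp: play_0 to_move_def)
    with j(2) show False by simp
  qed
next
  assume "\<exists>n. wins_within conv moves n x"
  then obtain n where n: "wins_within conv moves n x" by blast
  have "play_won_by conv moves First (play (best_strategy conv moves) \<tau> x)"
    if "legal_strategy moves \<tau>" for \<tau>
  proof -
    have "plays_best conv moves First (play (best_strategy conv moves) \<tau> x)"
      using legal_best_strategy[OF fin] that by (rule plays_best_play) simp
    from plays_best_wins[OF fin this, of 0 n] n show ?thesis
      by (auto simp: play_won_by_iff ends_at_def play_0 to_move_def)
  qed
  then show "first_wins conv moves x"
    unfolding first_wins_def using legal_best_strategy[OF fin] by blast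
qed

lemma first_loses_iff:
  assumes fin: "\<forall>x. finite (moves x)"
  shows "first_loses conv moves x \<longleftrightarrow> (\<exists>n. loses_within conv moves n x)"
proof
  assume "first_loses conv moves x"
  then obtain \<tau> where \<tau>: "legal_strategy moves \<tau>"
    "\<And>\<sigma>. legal_strategy moves \<sigma> \<Longrightarrow> play_won_by conv moves Second (play \<sigma> \<tau> x)"
    unfolding first_loses_def by blast
  let ?q = "play (best_strategy conv moves) \<tau> x"
  have q: "plays_best conv moves First ?q"
    using legal_best_strategy[OF fin] \<tau>(1) by (rule plays_best_play) simp
  obtain j where j: "ends_at moves ?q j" "winner conv j = Second"
    using \<tau>(2)[OF legal_best_strategy[OF fin]] unfolding play_won_by_iff by blast
  show "\<exists>n. loses_within conv moves n x"
  proof (rule ccontr)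
    assume "\<nexists>n. loses_within conv moves n x"
    then have "winner conv j = First"
      by (intro plays_best_never_loses[OF fin q _ j(1)]) (auto simp: play_0 to_move_def)
    with j(2) show False by simp
  qed
next
  assume "\<exists>n. loses_within conv moves n x"
  then obtain n where n: "loses_within conv moves n x" by blast
  have "play_won_by conv moves Second (play \<sigma> (best_strategy conv moves) x)"
    if "legal_strategy moves \<sigma>" for \<sigma>
  proof -
    have "plays_best conv moves Second (play \<sigma> (best_strategy conv moves) x)"
      using that legal_best_strategy[OF fin] by (rule plays_best_play) simp
    from plays_best_wins[OF fin this, of 0 n] n show ?thesis
      by (auto simp: play_won_by_iff ends_at_def play_0 to_move_def)
  qed
  then show "first_loses conv moves x"
    unfolding first_loses_def using legal_best_strategy[OF fin] by blast
qed

lemma not_wins_and_loses: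
  assumes fin: "\<forall>x. finite (moves x)"
  shows "\<not> (first_wins conv moves x \<and> first_loses conv moves x)"
proof
  assume "first_wins conv moves x \<and> first_loses conv moves x"
  then obtain m n where "wins_within conv moves m x" "loses_within conv moves n x"
    unfolding first_wins_iff[OF fin] first_loses_iff[OF fin] by blast
  then have "wins_within conv moves (max m n) x" "loses_within conv moves (max m n) x"
    by (auto intro: wins_within_mono[of _ _ m] loses_within_mono[of _ _ n])
  with not_both_within[of conv moves "max m n" x] show False by blast
qed

section \<open>The two-jump game on a tree, in terms of subtrees\<close>

definition subtree :: "nat \<Rightarrow> (vertex \<Rightarrow> nat) \<Rightarrow> vertex \<Rightarrow> nat" where
  "subtree i c = (\<lambda>v. c (i # v))"

definition all_children :: "(vertex \<Rightarrow> nat) set \<Rightarrow> (vertex \<Rightarrow> nat) set" where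
  "all_children A = {c. \<forall>i<c []. subtree i c \<in> A}"

definition some_child :: "(vertex \<Rightarrow> nat) set \<Rightarrow> (vertex \<Rightarrow> nat) set" where
  "some_child A = {c. \<exists>i<c []. subtree i c \<in> A}"

lemma some_child_eq: "some_child A = - all_children (- A)"
  by (auto simp: some_child_def all_children_def)

lemma children_Cons: "children c (i # v) = (#) i ` children (subtree i c) v"
  by (auto simp: children_def subtree_def)

text \<open>The game below the child \<open>[i]\<close> is a copy of the game on the subtree at that child.\<close>

lemma moves2_Cons: "moves2 c (i # v) = (#) i ` moves2 (subtree i c) v"
  unfolding moves2_def children_Cons by (auto simp: children_Cons)

lemma finite_moves2: "\<forall>v. finite (moves2 c v)"
proof
  have "children c u = (\<lambda>i. u @ [i]) ` {..<c u}" for u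
    by (auto simp: children_def)
  then show "finite (moves2 c v)" for v unfolding moves2_def by simp
qed

lemma Bex_moves2_root:
  "(\<exists>y\<in>moves2 c []. P y) \<longleftrightarrow> (\<exists>i<c []. P [i]) \<or> (\<exists>i<c []. \<exists>j<subtree i c []. P [i, j])"
  unfolding moves2_def children_def subtree_def by auto

lemma Ball_moves2_root:
  "(\<forall>y\<in>moves2 c []. P y) \<longleftrightarrow> (\<forall>i<c []. P [i]) \<and> (\<forall>i<c []. \<forall>j<subtree i c []. P [i, j])"
  unfolding moves2_def children_def subtree_def by auto

lemma within_Cons:
  "wins_within conv (moves2 c) n (i # v) = wins_within conv (moves2 (subtree i c)) n v \<and>
   loses_within conv (moves2 c) n (i # v) = loses_within conv (moves2 (subtree i c)) n v"
  by (induction n arbitrary: v) (auto simp: moves2_Cons)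

definition win_trees :: "convention \<Rightarrow> nat \<Rightarrow> (vertex \<Rightarrow> nat) set" where
  "win_trees conv n = {c. wins_within conv (moves2 c) n []}"

definition loss_trees :: "convention \<Rightarrow> nat \<Rightarrow> (vertex \<Rightarrow> nat) set" where
  "loss_trees conv n = {c. loses_within conv (moves2 c) n []}"

abbreviation leaf :: "(vertex \<Rightarrow> nat) set" where
  "leaf \<equiv> {c. c [] = 0}"

lemma moves2_root_empty: "moves2 c [] = {} \<longleftrightarrow> c [] = 0"
  by (auto simp: moves2_def children_def)

text \<open>The nested operator describes the grandchildren, which are the second kind of target of a move.\<close>

lemma win_trees_Suc:
  "win_trees conv (Suc n) = (if conv = Misere then leaf else {}) \<union> some_child (loss_trees conv n)
     \<union> some_child (some_child (loss_trees conv n))"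
  unfolding win_trees_def loss_trees_def some_child_def wins_within.simps Bex_moves2_root moves2_root_empty
  by (auto simp: within_Cons)

lemma loss_trees_Suc:
  "loss_trees conv (Suc n) = all_children (win_trees conv n) \<inter> all_children (all_children (win_trees conv n))
     - (if conv = Misere then leaf else {})"
  unfolding win_trees_def loss_trees_def all_children_def loses_within.simps Ball_moves2_root moves2_root_empty
  by (auto simp: within_Cons)

lemma win_trees_0 [simp]: "win_trees conv 0 = {}" and loss_trees_0 [simp]: "loss_trees conv 0 = {}"
  by (auto simp: win_trees_def loss_trees_def)

lemma incseq_win_trees: "incseq (win_trees conv)" and incseq_loss_trees: "incseq (loss_trees conv)"
  by (auto simp: incseq_def win_trees_def loss_trees_def intro: wins_within_mono loses_within_mono)

section \<open>The branching property of the Galton-Watson tree\<close>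

lemma space_GW [simp]: "space (GW r) = UNIV"
  by (simp add: GW_def space_PiM)

lemma prob_space_GW: "prob_space (GW r)"
  unfolding GW_def by (intro prob_space_PiM measure_pmf.prob_space_axioms)

lemma measurable_offspring [measurable]: "(\<lambda>c. c v) \<in> GW r \<rightarrow>\<^sub>M count_space UNIV"
  unfolding GW_def
  using measurable_component_singleton[of v UNIV "\<lambda>_. measure_pmf (poisson_pmf r)"] by simp

lemma measurable_subtree [measurable]: "subtree i \<in> GW r \<rightarrow>\<^sub>M GW r"
  unfolding subtree_def GW_def
  by (rule measurable_PiM_single') (auto simp: space_PiM measurable_offspring[unfolded GW_def])

text \<open>A subtree is the family of offspring numbers reindexed along the injection \<open>v \<mapsto> i # v\<close>, and
  reindexing an i.i.d. family gives a family with the same law.\<close>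

lemma distr_subtree: "distr (GW r) (GW r) (subtree i) = GW r"
proof -
  have "distr (GW r) (GW r) (\<lambda>c. \<lambda>v\<in>UNIV. c (i # v)) = GW r"
    unfolding GW_def
    by (rule distr_PiM_reindex[where f = "(#) i"]) (auto intro: measure_pmf.prob_space_axioms)
  then show ?thesis by (simp add: subtree_def[abs_def] restrict_def)
qed

lemma measure_subtree:
  assumes "A \<in> sets (GW r)"
  shows "measure (GW r) (subtree i -` A) = measure (GW r) A"
  using measure_distr[OF measurable_subtree assms, of i] unfolding distr_subtree by simp

lemma measure_offspring:
  assumes "r > 0"
  shows "measure (GW r) {c. c v = k} = r ^ k / fact k * exp (- r)"
proof -
  have "distr (GW r) (measure_pmf (poisson_pmf r)) (\<lambda>c. c v) = measure_pmf (poisson_pmf r)"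
    unfolding GW_def by (rule distr_PiM_component) (auto intro: measure_pmf.prob_space_axioms)
  then have "measure (measure_pmf (poisson_pmf r)) {k}
      = measure (distr (GW r) (measure_pmf (poisson_pmf r)) (\<lambda>c. c v)) {k}"
    by simp
  also have "\<dots> = measure (GW r) {c. c v = k}"
    by (subst measure_distr) (auto simp: vimage_def)
  finally show ?thesis
    using assms by (simp add: measure_pmf_single)
qed

text \<open>The offspring number of the root and the subtrees at its children are functions of the offspring
  numbers in the disjoint blocks \<open>{[]}\<close> and \<open>{i # v | v}\<close>, hence independent.\<close>

lemma measure_offspring_subtrees:
  assumes A: "A \<in> sets (GW r)"
  shows "measure (GW r) {c. c [] = k \<and> (\<forall>i<k. subtree i c \<in> A)}
       = measure (GW r) {c. c [] = k} * measure (GW r) A ^ k"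
proof -
  interpret prob_space "GW r" by (rule prob_space_GW)
  let ?M = "\<lambda>_::vertex. measure_pmf (poisson_pmf r)"
  \<comment> \<open>\<open>K\<close> is the partition into blocks, the root being block \<open>0\<close> and the subtree \<open>i\<close> block
    \<open>i + 1\<close>; \<open>B j\<close> is the event of interest read off from the coordinates in block \<open>j\<close>.\<close>
  define K where "K j = (case j of 0 \<Rightarrow> {[]} | Suc i \<Rightarrow> range ((#) i))" for j :: nat
  define B where "B j = (case j of 0 \<Rightarrow> {g \<in> space (PiM (K 0) ?M). g [] = k}
     | Suc i \<Rightarrow> subtree i -` A \<inter> space (PiM (K (Suc i)) ?M))" for j
  define X where "X j c = restrict (\<lambda>v. c v) (K j)" for j and c :: "vertex \<Rightarrow> nat"
  have "indep_vars ?M (\<lambda>v c. c v) UNIV"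
  proof (subst indep_vars_iff_distr_eq_PiM)
    show "distr (GW r) (PiM UNIV ?M) (\<lambda>c. \<lambda>v\<in>UNIV. c v)
        = (\<Pi>\<^sub>M v\<in>UNIV. distr (GW r) (?M v) (\<lambda>c. c v))"
      unfolding GW_def
      by (subst distr_PiM_component)
         (auto intro: measure_pmf.prob_space_axioms simp: restrict_def distr_id[unfolded id_def])
  qed auto
  then have ind: "indep_vars (\<lambda>j. PiM (K j) ?M) X UNIV"
    unfolding X_def[abs_def]
    by (rule indep_vars_restrict) (auto simp: K_def disjoint_family_on_def split: nat.splits)
  have B: "B j \<in> sets (PiM (K j) ?M)" for j
  proof (cases j)
    case 0
    have "(\<lambda>g. g []) \<in> PiM {[]} ?M \<rightarrow>\<^sub>M ?M []"
      by (rule measurable_component_singleton) simp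
    from measurable_sets[OF this, of "{k}"] show ?thesis
      by (simp add: 0 B_def K_def vimage_def Int_def conj_commute)
  next
    case (Suc i)
    have "subtree i \<in> PiM (K (Suc i)) ?M \<rightarrow>\<^sub>M GW r"
      unfolding GW_def subtree_def
    proof (rule measurable_PiM_single')
      show "(\<lambda>c. c (i # v)) \<in> PiM (K (Suc i)) ?M \<rightarrow>\<^sub>M ?M v" for v
        by (rule measurable_component_singleton) (simp add: K_def)
    qed (auto simp: space_PiM)
    from measurable_sets[OF this A] show ?thesis by (simp add: Suc B_def)
  qed
  have X_0: "X 0 -` B 0 \<inter> space (GW r) = {c. c [] = k}"
    by (auto simp: X_def B_def K_def space_PiM)
  have X_Suc: "X (Suc i) -` B (Suc i) \<inter> space (GW r) = subtree i -` A" for i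
    by (auto simp: X_def B_def K_def space_PiM subtree_def)
  have "prob (\<Inter>j\<in>{..k}. X j -` B j \<inter> space (GW r)) = (\<Prod>j\<in>{..k}. prob (X j -` B j \<inter> space (GW r)))"
    by (rule indep_varsD[OF ind _ _ _ B]) auto
  also have "(\<Inter>j\<in>{..k}. X j -` B j \<inter> space (GW r)) = {c. c [] = k \<and> (\<forall>i<k. subtree i c \<in> A)}"
  proof -
    have "{..k} = insert 0 (Suc ` {..<k})"
      by (simp only: lessThan_Suc_atMost[symmetric] lessThan_Suc_eq_insert_0)
    then show ?thesis using X_0 X_Suc by auto
  qed
  also have "(\<Prod>j\<in>{..k}. prob (X j -` B j \<inter> space (GW r)))
      = prob {c. c [] = k} * (\<Prod>i<k. prob A)"
    unfolding prod.atMost_shift X_0 X_Suc measure_subtree[OF A] ..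
  finally show ?thesis by simp
qed

lemma sets_all_children [measurable]:
  assumes [measurable]: "A \<in> sets (GW r)"
  shows "all_children A \<in> sets (GW r)"
proof -
  have "{c \<in> space (GW r). \<forall>i. i < c [] \<longrightarrow> subtree i c \<in> A} \<in> sets (GW r)"
    by measurable
  then show ?thesis by (simp add: all_children_def)
qed

lemma sets_some_child [measurable]:
  assumes "A \<in> sets (GW r)"
  shows "some_child A \<in> sets (GW r)"
  using sets.compl_sets[OF sets_all_children[OF sets.compl_sets[OF assms]]]
  by (simp add: some_child_eq Compl_eq_Diff_UNIV)

text \<open>The probability generating function of the Poisson distribution at the probability of \<open>A\<close>:
  the tree has \<open>k\<close> children with probability \<open>exp (- r) * r ^ k / fact k\<close>, and then all of their
  independent subtrees lie in \<open>A\<close> with probability \<open>measure (GW r) A ^ k\<close>.\<close>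

lemma measure_all_children:
  assumes r: "r > 0" and A: "A \<in> sets (GW r)"
  shows "measure (GW r) (all_children A) = exp (- r * (1 - measure (GW r) A))"
proof -
  interpret prob_space "GW r" by (rule prob_space_GW)
  define E where "E k = {c. c [] = k \<and> (\<forall>i<k. subtree i c \<in> A)}" for k
  have "E k = all_children A \<inter> {c \<in> space (GW r). c [] = k}" for k
    by (auto simp: E_def all_children_def)
  then have "E k \<in> events" for k
    using sets_all_children[OF A] by auto
  then have "(\<lambda>k. prob (E k)) sums prob (\<Union>k. E k)"
    by (intro finite_measure_UNION) (auto simp: disjoint_family_on_def E_def)
  also have "(\<Union>k. E k) = all_children A"
    by (auto simp: E_def all_children_def)
  also have "(\<lambda>k. prob (E k)) = (\<lambda>k. exp (- r) * ((r * prob A) ^ k /\<^sub>R fact k))"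
    unfolding E_def measure_offspring_subtrees[OF A] measure_offspring[OF r]
    by (simp add: fun_eq_iff power_mult_distrib field_simps)
  finally have "(\<lambda>k. exp (- r) * ((r * prob A) ^ k /\<^sub>R fact k)) sums prob (all_children A)" .
  moreover have "(\<lambda>k. exp (- r) * ((r * prob A) ^ k /\<^sub>R fact k)) sums (exp (- r) * exp (r * prob A))"
    by (intro sums_mult exp_converges)
  ultimately have "prob (all_children A) = exp (- r) * exp (r * prob A)"
    by (rule sums_unique2)
  also have "\<dots> = exp (- r * (1 - prob A))"
    by (simp add: exp_add[symmetric] algebra_simps)
  finally show ?thesis .
qed

lemma measure_some_child:
  assumes r: "r > 0" and A: "A \<in> sets (GW r)"
  shows "measure (GW r) (some_child A) = 1 - exp (- r * measure (GW r) A)"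
proof -
  interpret prob_space "GW r" by (rule prob_space_GW)
  have "prob (- A) = 1 - prob A"
    using prob_compl[OF A] by (simp add: Compl_eq_Diff_UNIV)
  moreover have "prob (some_child A) = 1 - prob (all_children (- A))"
    using prob_compl[OF sets_all_children[OF sets.compl_sets[OF A]]]
    by (simp add: some_child_eq Compl_eq_Diff_UNIV)
  moreover have "- A \<in> events" using sets.compl_sets[OF A] by (simp add: Compl_eq_Diff_UNIV)
  ultimately show ?thesis using measure_all_children[OF r, of "- A"] by simp
qed

lemma measure_some_child_le:
  assumes r: "r > 0" and A: "A \<in> sets (GW r)"
  shows "measure (GW r) (some_child A) \<le> r * measure (GW r) A"
  using exp_ge_add_one_self[of "- r * measure (GW r) A"] by (simp add: measure_some_child[OF assms])

lemma sets_leaf: "leaf \<in> sets (GW r)"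
  using measurable_sets[OF measurable_offspring, of "{0}" "[]" r] by (simp add: vimage_def)

lemma sets_win_trees: "win_trees conv n \<in> sets (GW r)" and sets_loss_trees: "loss_trees conv n \<in> sets (GW r)"
proof (induction n)
  case (Suc n)
  {
    case 1
    show ?case unfolding win_trees_Suc using Suc
      by (auto intro!: sets_some_child sets_leaf)
  next
    case 2
    show ?case unfolding loss_trees_Suc using Suc
      by (auto intro!: sets_all_children sets_leaf)
  }
qed simp_all

section \<open>Estimates for the stages of the backward induction\<close>

text \<open>The probability that the root is terminal and won for that reason.\<close>

abbreviation leaf_win_prob :: "convention \<Rightarrow> real \<Rightarrow> real" where
  "leaf_win_prob conv r \<equiv> (if conv = Misere then exp (- r) else 0)"

lemma measure_leaf: "r > 0 \<Longrightarrow> measure (GW r) leaf = exp (- r)"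
  by (simp add: measure_offspring)

text \<open>A union bound over the ways to win: being terminal in the misere game, having a lost child, having
  a lost grandchild. The weights \<open>r\<close> and \<open>r\<^sup>2\<close> are the mean numbers of children and grandchildren.\<close>

lemma measure_win_trees_le:
  assumes r: "r > 0"
  shows "measure (GW r) (win_trees conv n) \<le> leaf_win_prob conv r + (r + r\<^sup>2) * measure (GW r) (loss_trees conv n)"
proof -
  interpret prob_space "GW r" by (rule prob_space_GW)
  let ?T = "if conv = Misere then leaf else {}"
  let ?S = "some_child (loss_trees conv n)"
  have S: "?S \<in> events" "some_child ?S \<in> events" "?T \<in> events"
    using sets_some_child sets_loss_trees sets_leaf by auto
  have "prob (win_trees conv n) \<le> prob (win_trees conv (Suc n))"
    using incseq_win_trees[of conv] sets_win_trees by (intro finite_measure_mono) (auto simp: incseq_Suc_iff)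
  also have "\<dots> \<le> prob ?T + prob ?S + prob (some_child ?S)"
    unfolding win_trees_Suc using S
    by (intro order.trans[OF measure_Un_le] add_mono) auto
  also have "prob (some_child ?S) \<le> r * (r * prob (loss_trees conv n))"
    using r measure_some_child_le[OF r S(1)] measure_some_child_le[OF r sets_loss_trees[of conv n]]
    by (meson mult_left_mono order.trans less_imp_le)
  also have "prob ?S \<le> r * prob (loss_trees conv n)"
    by (rule measure_some_child_le[OF r sets_loss_trees])
  also have "prob ?T = leaf_win_prob conv r"
    using measure_leaf[OF r] by auto
  finally show ?thesis by (simp add: algebra_simps power2_eq_square)
qed

text \<open>The condition on the grandchildren alone gives this bound: two applications of the branching
  property turn it into an iterated exponential. A leaf satisfies the condition vacuously and is
  therefore subtracted in the misere game, where it is not lost.\<close>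

lemma measure_loss_trees_Suc_le:
  assumes r: "r > 0"
  shows "measure (GW r) (loss_trees conv (Suc n))
    \<le> exp (- r * (1 - exp (- r * (1 - measure (GW r) (win_trees conv n))))) - leaf_win_prob conv r"
proof -
  interpret prob_space "GW r" by (rule prob_space_GW)
  let ?T = "if conv = Misere then leaf else {}"
  let ?A = "all_children (all_children (win_trees conv n))"
  have A: "?A \<in> events" "?T \<in> events" using sets_all_children sets_win_trees sets_leaf by auto
  have "prob (loss_trees conv (Suc n)) \<le> prob (?A - ?T)"
    unfolding loss_trees_Suc using A by (intro finite_measure_mono) auto
  also have "\<dots> = prob ?A - prob ?T"
    using A by (intro finite_measure_Diff) (auto simp: all_children_def)
  also have "prob ?T = leaf_win_prob conv r"
    using measure_leaf[OF r] by auto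
  also have "prob ?A = exp (- r * (1 - exp (- r * (1 - prob (win_trees conv n)))))"
    by (simp add: measure_all_children r sets_all_children sets_win_trees)
  finally show ?thesis .
qed

text \<open>A bound \<open>d\<close> on the loss probability keeps the win probability at most \<open>1 / 2\<close>. Then a vertex has
  only won children with probability at most \<open>exp (- r / 2)\<close>, so that all children of the root are
  of that kind with probability at most \<open>exp (- r) * exp (r * exp (- r / 2))\<close>. After subtraction of
  the leaves, where they are wins, this is again at most \<open>d\<close>. The induction selects the smallest fixed point of the recursion, which the fixed point
  equation alone would not do.\<close>

lemma measure_loss_trees_le:
  assumes r: "r > 0" and d: "d \<ge> 0"
    and half: "leaf_win_prob conv r + (r + r\<^sup>2) * d \<le> 1 / 2"
    and closed: "exp (- r) * exp (r * exp (- r / 2)) - leaf_win_prob conv r \<le> d"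
  shows "measure (GW r) (loss_trees conv n) \<le> d"
proof (induction n)
  case 0
  show ?case using d by simp
next
  case (Suc n)
  have "(r + r\<^sup>2) * measure (GW r) (loss_trees conv n) \<le> (r + r\<^sup>2) * d"
    using Suc r by (intro mult_left_mono) auto
  then have "measure (GW r) (win_trees conv n) \<le> 1 / 2"
    using measure_win_trees_le[OF r, of conv n] half by linarith
  then have "r * (1 / 2) \<le> r * (1 - measure (GW r) (win_trees conv n))"
    using r by (intro mult_left_mono) auto
  then have "exp (- r * (1 - measure (GW r) (win_trees conv n))) \<le> exp (- r / 2)"
    by simp
  then have "r * exp (- r * (1 - measure (GW r) (win_trees conv n))) \<le> r * exp (- r / 2)"
    using r by (intro mult_left_mono) auto
  then have "exp (- r * (1 - exp (- r * (1 - measure (GW r) (win_trees conv n)))))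
      \<le> exp (- r + r * exp (- r / 2))"
    by (simp add: algebra_simps)
  also have "\<dots> = exp (- r) * exp (r * exp (- r / 2))"
    by (rule exp_add)
  finally show ?case
    using measure_loss_trees_Suc_le[OF r, of conv n] closed by linarith
qed

lemma first_wins_set: "{c. first_wins conv (moves2 c) []} = (\<Union>n. win_trees conv n)"
  and first_loses_set: "{c. first_loses conv (moves2 c) []} = (\<Union>n. loss_trees conv n)"
  by (auto simp: first_wins_iff[OF finite_moves2] first_loses_iff[OF finite_moves2] win_trees_def loss_trees_def)

lemma measure_UN_le:
  assumes "incseq A" "\<And>n. A n \<in> sets (GW r)" "\<And>n. measure (GW r) (A n) \<le> d"
  shows "measure (GW r) (\<Union>n. A n) \<le> d"
proof -
  interpret prob_space "GW r" by (rule prob_space_GW)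
  have "(\<lambda>n. prob (A n)) \<longlonglongrightarrow> prob (\<Union>n. A n)"
    using assms(1,2) by (intro finite_Lim_measure_incseq) auto
  then show ?thesis by (rule LIMSEQ_le_const2) (use assms(3) in auto)
qed

section \<open>Outcome probabilities\<close>

definition lose_prob :: "convention \<Rightarrow> real \<Rightarrow> real" where
  "lose_prob conv r = measure (GW r) (\<Union>n. loss_trees conv n)"

definition win_prob :: "convention \<Rightarrow> real \<Rightarrow> real" where
  "win_prob conv r = measure (GW r) (\<Union>n. win_trees conv n)"

text \<open>The outcome classes are measurable because they are countable unions of stages, so the rule for
  complements applies to the draws.\<close>

lemma measure_drawn:
  "measure (GW r) {c. drawn conv (moves2 c) []} = 1 - win_prob conv r - lose_prob conv r"
proof -
  interpret prob_space "GW r" by (rule prob_space_GW)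
  let ?w = "\<Union>n. win_trees conv n" and ?l = "\<Union>n. loss_trees conv n"
  have ev: "?w \<in> events" "?l \<in> events" using sets_win_trees sets_loss_trees by auto
  have "?w \<inter> ?l = {}"
    unfolding first_wins_set[symmetric] first_loses_set[symmetric]
    using not_wins_and_loses[OF finite_moves2] by auto
  then have "prob (?w \<union> ?l) = prob ?w + prob ?l"
    using ev by (intro finite_measure_Union)
  moreover have "{c. drawn conv (moves2 c) []} = space (GW r) - (?w \<union> ?l)"
    unfolding first_wins_set[symmetric] first_loses_set[symmetric] by (auto simp: drawn_def)
  ultimately show ?thesis
    using prob_compl[of "?w \<union> ?l"] ev by (simp add: win_prob_def lose_prob_def)
qed

lemma lose_prob_le:
  assumes "r > 0" "d \<ge> 0" "leaf_win_prob conv r + (r + r\<^sup>2) * d \<le> 1 / 2"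
    "exp (- r) * exp (r * exp (- r / 2)) - leaf_win_prob conv r \<le> d"
  shows "lose_prob conv r \<le> d"
  unfolding lose_prob_def
  by (rule measure_UN_le[OF incseq_loss_trees sets_loss_trees measure_loss_trees_le[OF assms]])

lemma win_prob_le:
  assumes r: "r > 0"
  shows "win_prob conv r \<le> leaf_win_prob conv r + (r + r\<^sup>2) * lose_prob conv r"
  unfolding win_prob_def
proof (rule measure_UN_le[OF incseq_win_trees sets_win_trees])
  fix n
  interpret prob_space "GW r" by (rule prob_space_GW)
  have "prob (loss_trees conv n) \<le> lose_prob conv r"
    unfolding lose_prob_def using sets_loss_trees by (intro finite_measure_mono) auto
  then have "(r + r\<^sup>2) * prob (loss_trees conv n) \<le> (r + r\<^sup>2) * lose_prob conv r"
    using r by (intro mult_left_mono) auto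
  with measure_win_trees_le[OF r, of conv n]
  show "prob (win_trees conv n) \<le> leaf_win_prob conv r + (r + r\<^sup>2) * lose_prob conv r" by linarith
qed

lemma leaf_subset_loss_trees: "leaf \<subseteq> loss_trees Normal (Suc 0)"
  by (auto simp: loss_trees_Suc all_children_def)

lemma lose_prob_Normal_ge:
  assumes r: "r > 0"
  shows "lose_prob Normal r \<ge> exp (- r)"
proof -
  interpret prob_space "GW r" by (rule prob_space_GW)
  have "prob leaf \<le> lose_prob Normal r"
    unfolding lose_prob_def using leaf_subset_loss_trees sets_loss_trees by (intro finite_measure_mono) auto
  then show ?thesis by (simp add: measure_leaf[OF r])
qed

text \<open>A root with a child that is a leaf wins by moving there.\<close>

lemma win_prob_Normal_ge:
  assumes r: "r > 0"
  shows "win_prob Normal r \<ge> 1 - exp (- r * exp (- r))"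
proof -
  interpret prob_space "GW r" by (rule prob_space_GW)
  have "some_child leaf \<subseteq> win_trees Normal (Suc (Suc 0))"
    unfolding win_trees_Suc[of Normal "Suc 0"] using leaf_subset_loss_trees by (auto simp: some_child_def)
  then have "prob (some_child leaf) \<le> win_prob Normal r"
    unfolding win_prob_def using sets_win_trees by (intro finite_measure_mono) auto
  then show ?thesis by (simp add: measure_some_child[OF r sets_leaf] measure_leaf[OF r])
qed

lemma probs_eq:
  "nl2 r = lose_prob Normal r" "nw2 r = win_prob Normal r"
  "nd2 r = 1 - win_prob Normal r - lose_prob Normal r"
  "ml2 r = lose_prob Misere r" "md2 r = 1 - win_prob Misere r - lose_prob Misere r"
  unfolding nl2_def nw2_def nd2_def ml2_def md2_def
  unfolding space_GW by (simp_all add: first_wins_set first_loses_set measure_drawn lose_prob_def win_prob_def)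

text \<open>The number \<open>2 * exp (- r)\<close> separates the loss probability of the normal game from its win
  probability, and also the probability that the misere game is decided from the probability that
  the normal game is decided.\<close>

theorem theorem1p7:
  shows "\<exists>r0>0. \<forall>r\<ge>r0.
    ml2 r \<le> nl2 r \<and> nd2 r < md2 r \<and> (ml2 r \<le> nl2 r \<and> nl2 r < nw2 r)"
proof -
  \<comment> \<open>In the misere game the bound \<open>d\<close> of \<open>measure_loss_trees_le\<close> has to be at least
    \<open>exp (- r) * (exp x - 1)\<close> with \<open>x = r * exp (- r / 2)\<close>. As \<open>x\<close> tends to \<open>0\<close>, eventually
    \<open>exp x - 1 \<le> 2 * x\<close>, and \<open>m r\<close> is \<open>exp (- r) * (2 * x)\<close>.\<close>
  define m :: "real \<Rightarrow> real" where "m = (\<lambda>r. 2 * r * exp (- 3 / 2 * r))"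
  have "\<forall>\<^sub>F r in at_top. (r + r\<^sup>2) * (2 * exp (- r)) \<le> (1 / 2 :: real)"
    by real_asymp
  moreover have "\<forall>\<^sub>F r in at_top. exp (r * exp (- r / 2)) \<le> (2 :: real)"
    by real_asymp
  moreover have "\<forall>\<^sub>F r in at_top. exp (- r) + (r + r\<^sup>2) * m r \<le> 1 / 2"
    unfolding m_def by real_asymp
  moreover have "\<forall>\<^sub>F r :: real in at_top. exp (r * exp (- r / 2)) - 1 \<le> 2 * r * exp (- r / 2)"
    by real_asymp
  moreover have "\<forall>\<^sub>F r in at_top. m r \<le> exp (- r)"
    unfolding m_def by real_asymp
  moreover have "\<forall>\<^sub>F r in at_top. 2 * exp (- r) < 1 - exp (- r * exp (- r) :: real)"
    by real_asymp
  moreover have "\<forall>\<^sub>F r in at_top. m r + (exp (- r) + (r + r\<^sup>2) * m r) < 2 * exp (- r)"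
    unfolding m_def by real_asymp
  moreover have "\<forall>\<^sub>F r :: real in at_top. r > 0"
    by (rule eventually_gt_at_top)
  ultimately have "\<forall>\<^sub>F r in at_top. r > 0 \<and>
    ml2 r \<le> nl2 r \<and> nd2 r < md2 r \<and> (ml2 r \<le> nl2 r \<and> nl2 r < nw2 r)"
  proof eventually_elim
    case (elim r)
    then have r: "r > 0" by simp
    have nl: "lose_prob Normal r \<le> 2 * exp (- r)"
      using elim by (intro lose_prob_le) auto
    have "exp (- r) * (exp (r * exp (- r / 2)) - 1) \<le> exp (- r) * (2 * r * exp (- r / 2))"
      using elim by (intro mult_left_mono) auto
    also have "\<dots> = 2 * r * (exp (- r) * exp (- r / 2))"
      by (simp only: mult_ac)
    also have "exp (- r) * exp (- r / 2) = exp (- 3 / 2 * r)"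
      by (simp add: exp_add[symmetric])
    finally have "exp (- r) * exp (r * exp (- r / 2)) - exp (- r) \<le> m r"
      by (simp add: m_def algebra_simps)
    then have ml: "lose_prob Misere r \<le> m r"
      using elim r by (intro lose_prob_le) (auto simp: m_def)
    have "(r + r\<^sup>2) * lose_prob Misere r \<le> (r + r\<^sup>2) * m r"
      using ml r by (intro mult_left_mono) auto
    then have mw: "win_prob Misere r \<le> exp (- r) + (r + r\<^sup>2) * m r"
      using win_prob_le[OF r, of Misere] by simp
    show ?case
      unfolding probs_eq
      using elim nl ml mw lose_prob_Normal_ge[OF r] win_prob_Normal_ge[OF r] by linarith
  qed
  then obtain N where N: "\<And>r. r \<ge> N \<Longrightarrow> r > 0 \<and>
    ml2 r \<le> nl2 r \<and> nd2 r < md2 r \<and> (ml2 r \<le> nl2 r \<and> nl2 r < nw2 r)"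
    unfolding eventually_at_top_linorder by blast
  then show ?thesis by (intro exI[of _ N]) auto
qed

end
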